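(* For any positive integer $k$, the number of ODD colored compositions of $k$ is equal to the number of $\binom{n}{2}$-color compositions of $k+1$.
   Context: A composition of a positive integer $k$ is a finite ordered sequence of positive integers (called parts) whose sum is $k$; positions of parts are numbered $1,2,3,\dots$ from left to right. An ODD colored composition of $k$ is a composition of $k$ in which each part in an odd position (1st, 3rd, ...) of size $p$ is given one of $p$ colors $1,\dots,p$, while the parts in even positions are not colored. A $\binom{n}{2}$-color composition of $k$ is a composition of $k$ in which each part of size $p$ is given one of $\binom{p}{2}$ colors; equivalently, each part of size $p$ is equipped with a 2-element subset of $\{1,\dots,p\}$ (in particular no part has size $1$, since $\binom{1}{2}=0$). *)

theory Defs
  imports Main
begin

definition compositions :: "nat \<Rightarrow> nat list set" where
  "compositions k = {ps. (\<forall>p \<in> set ps. 0 < p) \<and> sum_list ps = k}"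

(* A colored composition is the list of its parts from left to right, each paired with its
   color.  In an ODD colored composition the color is None exactly at the uncolored parts.
   Positions are counted from 1, list indices from 0, so index i is position i + 1. *)

definition ODD_colored_compositions :: "nat \<Rightarrow> (nat \<times> nat option) list set" where
  "ODD_colored_compositions k =
    {xs. map fst xs \<in> compositions k \<and>
         (\<forall>i < length xs.
            if odd (i + 1) then snd (xs ! i) \<in> Some ` {1..fst (xs ! i)}
            else snd (xs ! i) = None)}"

definition choose2_color_compositions :: "nat \<Rightarrow> (nat \<times> nat) list set" where
  "choose2_color_compositions k =
    {xs. map fst xs \<in> compositions k \<and>
         (\<forall>(p, c) \<in> set xs. c \<in> {1..p choose 2})}"

lemma length_le_of_composition:
  assumes "ps \<in> compositions k"
  shows "length ps \<le> k"
proof -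
  have "(\<forall>p \<in> set ps. 0 < p) \<Longrightarrow> length ps \<le> sum_list ps"
    by (induction ps) auto
  then show ?thesis
    using assms by (simp add: compositions_def)
qed

lemma part_le_of_composition:
  assumes "ps \<in> compositions k" and "p \<in> set ps"
  shows "p \<le> k"
  using assms member_le_sum_list by (auto simp: compositions_def)

(* The sets below are finite, so that card really counts them. *)

lemma finite_ODD_colored_compositions: "finite (ODD_colored_compositions k)"
proof (rule finite_subset)
  let ?A = "{..k} \<times> insert None (Some ` {..k})"
  show "finite {xs. set xs \<subseteq> ?A \<and> length xs \<le> k}"
    by (rule finite_lists_length_le) simp
  show "ODD_colored_compositions k \<subseteq> {xs. set xs \<subseteq> ?A \<and> length xs \<le> k}"
  proof
    fix xs assume xs: "xs \<in> ODD_colored_compositions k"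
    then have comp: "map fst xs \<in> compositions k"
      by (simp add: ODD_colored_compositions_def)
    have "xs ! i \<in> ?A" if i: "i < length xs" for i
    proof -
      have le: "fst (xs ! i) \<le> k"
        using part_le_of_composition[OF comp, of "fst (xs ! i)"] i by simp
      have "if odd (i + 1) then snd (xs ! i) \<in> Some ` {1..fst (xs ! i)}
            else snd (xs ! i) = None"
        using xs i unfolding ODD_colored_compositions_def by blast
      then have "snd (xs ! i) \<in> insert None (Some ` {..k})"
        using le by (auto split: if_splits)
      then show ?thesis
        using le by (simp add: mem_Times_iff)
    qed
    then have "set xs \<subseteq> ?A"
      by (metis in_set_conv_nth subsetI)
    then show "xs \<in> {xs. set xs \<subseteq> ?A \<and> length xs \<le> k}"
      using length_le_of_composition[OF comp] by simp
  qed
qed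

lemma finite_choose2_color_compositions: "finite (choose2_color_compositions k)"
proof (rule finite_subset)
  let ?A = "Sigma {..k} (\<lambda>p. {1..p choose 2})"
  show "finite {xs. set xs \<subseteq> ?A \<and> length xs \<le> k}"
    by (rule finite_lists_length_le) simp
  show "choose2_color_compositions k \<subseteq> {xs. set xs \<subseteq> ?A \<and> length xs \<le> k}"
  proof
    fix xs assume xs: "xs \<in> choose2_color_compositions k"
    then have comp: "map fst xs \<in> compositions k"
      by (simp add: choose2_color_compositions_def)
    have "x \<in> ?A" if x: "x \<in> set xs" for x
    proof -
      have "fst x \<le> k"
        using part_le_of_composition[OF comp, of "fst x"] x by simp
      moreover have "snd x \<in> {1..fst x choose 2}"
        using xs x by (auto simp: choose2_color_compositions_def)
      ultimately show ?thesis
        by (cases x) simp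
    qed
    then show "xs \<in> {xs. set xs \<subseteq> ?A \<and> length xs \<le> k}"
      using length_le_of_composition[OF comp] by auto
  qed
qed

end

(* Joining each odd-position part with the even-position part after it turns a pair (colored p, q)
   into a part m = p + q, with 1 + ... + (m - 1) = m choose 2 possibilities.  Removing the first
   joined pair, respectively the first part, shows that the number of ODD colored compositions of k
   and the number of binomial-colored compositions of k + 1 both satisfy
   a k = (k + 1 choose 2) + (SUM m<k. (m choose 2) * a (k - m)). *)

theory Submission
  imports Defs
begin

lemma Nil_in_ODD_iff: "[] \<in> ODD_colored_compositions k \<longleftrightarrow> k = 0"
  by (auto simp: ODD_colored_compositions_def compositions_def)

lemma singleton_in_ODD_iff:
  "[(p, c)] \<in> ODD_colored_compositions k \<longleftrightarrow> p = k \<and> c \<in> Some ` {1..k}"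
  by (auto simp: ODD_colored_compositions_def compositions_def)

text \<open>Dropping two parts preserves the parity of every later position, so what remains obeys
  the same coloring rule. This is why parts are removed in pairs.\<close>

lemma Cons_Cons_in_ODD_iff:
  "(p, c) # (q, d) # xs \<in> ODD_colored_compositions k \<longleftrightarrow>
    c \<in> Some ` {1..p} \<and> 0 < q \<and> d = None \<and> p + q \<le> k \<and>
    xs \<in> ODD_colored_compositions (k - (p + q))"
proof -
  have split: "(\<forall>i < length ((p, c) # (q, d) # xs). P i) \<longleftrightarrow>
      P 0 \<and> P 1 \<and> (\<forall>i < length xs. P (Suc (Suc i)))" for P
    by (auto simp: less_Suc_eq_0_disj)
  show ?thesis
    unfolding ODD_colored_compositions_def mem_Collect_eq split
    by (auto simp: compositions_def)
qed

lemma ODD_colored_compositions_0: "ODD_colored_compositions 0 = {[]}"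
proof -
  have "xs = []" if "xs \<in> ODD_colored_compositions 0" for xs
    using that length_le_of_composition[of "map fst xs" 0]
    by (simp add: ODD_colored_compositions_def)
  then show ?thesis
    by (auto simp: ODD_colored_compositions_def compositions_def)
qed

text \<open>A single part has no even-position partner, which gives the first set. Otherwise
  \<open>m\<close> is the sum of the first two parts: \<open>p < m\<close> keeps the second part
  \<open>m - p\<close> positive, and \<open>m = k\<close> covers the lists of exactly two
  parts.\<close>

lemma ODD_colored_compositions_unfold:
  assumes "0 < k"
  shows "ODD_colored_compositions k =
    (\<lambda>c. [(k, Some c)]) ` {1..k} \<union>
    (\<lambda>(m, (p, c), xs). (p, Some c) # (m - p, None) # xs) `
      (SIGMA m:{..k}. (SIGMA p:{..<m}. {1..p}) \<times> ODD_colored_compositions (k - m))"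
    (is "_ = ?A \<union> ?f ` ?B")
proof (intro equalityI subsetI)
  fix xs assume xs: "xs \<in> ODD_colored_compositions k"
  consider "xs = []" | p c where "xs = [(p, c)]" | p c q d ys where "xs = (p, c) # (q, d) # ys"
    by (cases xs rule: remdups_adj.cases) auto
  then show "xs \<in> ?A \<union> ?f ` ?B"
  proof cases
    case 1
    then show ?thesis using xs assms by (simp add: Nil_in_ODD_iff)
  next
    case 2
    then show ?thesis using xs by (auto simp: singleton_in_ODD_iff)
  next
    case 3
    then obtain e where "c = Some e" "e \<in> {1..p}" "0 < q" "d = None" "p + q \<le> k"
      "ys \<in> ODD_colored_compositions (k - (p + q))"
      using xs by (auto simp: Cons_Cons_in_ODD_iff)
    then have "xs = ?f (p + q, (p, e), ys)" "(p + q, (p, e), ys) \<in> ?B"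
      using 3 by auto
    then show ?thesis by blast
  qed
next
  fix xs assume "xs \<in> ?A \<union> ?f ` ?B"
  then show "xs \<in> ODD_colored_compositions k"
    by (auto simp: singleton_in_ODD_iff Cons_Cons_in_ODD_iff)
qed

lemma sum_lessThan_eq_choose2: "\<Sum>{..<m} = m choose 2"
  by (induction m) (simp_all add: numeral_2_eq_2)

lemma card_ODD_colored_compositions:
  assumes "0 < k"
  shows "card (ODD_colored_compositions k) =
    (k + 1 choose 2) + (\<Sum>m<k. (m choose 2) * card (ODD_colored_compositions (k - m)))"
proof -
  let ?f = "\<lambda>(m, (p, c), xs). (p, Some c) # (m - p, None) # xs"
  let ?B = "SIGMA m:{..k}. (SIGMA p:{..<m}. {1..p}) \<times> ODD_colored_compositions (k - m)"
  \<comment> \<open>The first two parts determine \<open>m = p + (m - p)\<close>, because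
    \<open>p < m\<close> on \<open>?B\<close>.\<close>
  have inj: "inj_on ?f ?B"
    by (auto simp: inj_on_def)
  have "finite ?B"
    by (auto simp: finite_ODD_colored_compositions)
  then have "card (ODD_colored_compositions k) =
      card ((\<lambda>c. [(k, Some c)]) ` {1..k}) + card (?f ` ?B)"
    unfolding ODD_colored_compositions_unfold[OF assms]
    by (intro card_Un_disjoint) auto
  also have "card ((\<lambda>c. [(k, Some c)]) ` {1..k}) = k"
    by (simp add: card_image inj_on_def)
  also have "card (?f ` ?B) = (\<Sum>m\<le>k. (m choose 2) * card (ODD_colored_compositions (k - m)))"
    unfolding card_image[OF inj]
    by (simp add: card_cartesian_product finite_ODD_colored_compositions sum_lessThan_eq_choose2)
  \<comment> \<open>The term \<open>m = k\<close> leaves only the empty list and contributes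
    \<open>k choose 2\<close>; with the \<open>k\<close> one-part lists this makes
    \<open>k + 1 choose 2\<close>.\<close>
  also have "k + \<dots> =
      (k + 1 choose 2) + (\<Sum>m<k. (m choose 2) * card (ODD_colored_compositions (k - m)))"
    by (simp add: ODD_colored_compositions_0 numeral_2_eq_2 flip: lessThan_Suc_atMost)
  finally show ?thesis .
qed

lemma Cons_in_choose2_iff:
  "(p, c) # xs \<in> choose2_color_compositions k \<longleftrightarrow>
    c \<in> {1..p choose 2} \<and> p \<le> k \<and> xs \<in> choose2_color_compositions (k - p)"
  \<comment> \<open>A part \<open>p = 0\<close> has no color since \<open>0 choose 2 = 0\<close>, so
    the existence of \<open>c\<close> already forces a positive part.\<close>
  by (cases "p = 0") (auto simp: choose2_color_compositions_def compositions_def)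

lemma choose2_color_compositions_0: "choose2_color_compositions 0 = {[]}"
proof -
  have "xs = []" if "xs \<in> choose2_color_compositions 0" for xs
    using that length_le_of_composition[of "map fst xs" 0]
    by (simp add: choose2_color_compositions_def)
  then show ?thesis
    by (auto simp: choose2_color_compositions_def compositions_def)
qed

lemma choose2_color_compositions_unfold:
  assumes "0 < k"
  shows "choose2_color_compositions k =
    (\<lambda>(m, c, xs). (m, c) # xs) `
      (SIGMA m:{..k}. {1..m choose 2} \<times> choose2_color_compositions (k - m))"
    (is "_ = ?f ` ?B")
proof (intro equalityI subsetI)
  fix xs assume xs: "xs \<in> choose2_color_compositions k"
  have "xs \<noteq> []"
    using xs assms by (auto simp: choose2_color_compositions_def compositions_def)
  then obtain p c ys where eq: "xs = (p, c) # ys"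
    by (cases xs) auto
  then have "(p, c, ys) \<in> ?B"
    using xs by (simp add: Cons_in_choose2_iff)
  then show "xs \<in> ?f ` ?B"
    using eq by force
qed (auto simp: Cons_in_choose2_iff)

lemma card_choose2_color_compositions:
  assumes "0 < k"
  shows "card (choose2_color_compositions k) =
    (\<Sum>m\<le>k. (m choose 2) * card (choose2_color_compositions (k - m)))"
proof -
  have "inj_on (\<lambda>(m, c, xs). (m, c) # xs) B" for B :: "(nat \<times> nat \<times> (nat \<times> nat) list) set"
    by (auto simp: inj_on_def)
  then show ?thesis
    unfolding choose2_color_compositions_unfold[OF assms]
    by (simp add: card_image card_cartesian_product finite_choose2_color_compositions)
qed

lemma card_choose2_color_compositions_Suc:
  "card (choose2_color_compositions (k + 1)) =
    (k + 1 choose 2) + (\<Sum>m<k. (m choose 2) * card (choose2_color_compositions (k - m + 1)))"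
proof -
  \<comment> \<open>In the recurrence at 1 both coefficients, \<open>0 choose 2\<close> and
    \<open>1 choose 2\<close>, vanish.\<close>
  have one: "card (choose2_color_compositions 1) = 0"
    by (subst card_choose2_color_compositions) (auto simp: choose2_color_compositions_0)
  \<comment> \<open>The two top terms of the recurrence are split off: \<open>m = k\<close> leaves
    the remainder 1 and vanishes, while \<open>m = k + 1\<close> leaves the empty composition and
    yields the summand \<open>k + 1 choose 2\<close>.\<close>
  have "card (choose2_color_compositions (k + 1)) =
      (\<Sum>m<k. (m choose 2) * card (choose2_color_compositions (k + 1 - m))) +
      (k choose 2) * card (choose2_color_compositions 1) +
      (k + 1 choose 2) * card (choose2_color_compositions 0)"
    by (subst card_choose2_color_compositions) (simp_all flip: lessThan_Suc_atMost)
  then show ?thesis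
    by (simp add: one[simplified] choose2_color_compositions_0 Suc_diff_le)
qed

theorem theorem3p2:
  fixes k :: nat
  assumes "0 < k"
  shows "card (ODD_colored_compositions k) = card (choose2_color_compositions (k + 1))"
  using assms
proof (induction k rule: less_induct)
  case (less k)
  have "card (ODD_colored_compositions (k - m)) = card (choose2_color_compositions (k - m + 1))"
    if "0 < m" "m < k" for m
    using less.IH[of "k - m"] that by simp
  \<comment> \<open>For \<open>m = 0\<close> the argument \<open>k - m\<close> is \<open>k\<close>
    itself, out of reach of the induction hypothesis, but the coefficient \<open>0 choose 2\<close>
    is zero.\<close>
  then have "(m choose 2) * card (ODD_colored_compositions (k - m)) =
      (m choose 2) * card (choose2_color_compositions (k - m + 1))" if "m < k" for m
    using that by (cases "m = 0") auto
  then have "(\<Sum>m<k. (m choose 2) * card (ODD_colored_compositions (k - m))) =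
      (\<Sum>m<k. (m choose 2) * card (choose2_color_compositions (k - m + 1)))"
    by (intro sum.cong refl) (simp only: lessThan_iff)
  then show ?case
    using card_ODD_colored_compositions[OF less.prems] card_choose2_color_compositions_Suc[of k]
    by (simp only:)
qed

end
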